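(* Identify $S^3\times S^1$ with $\operatorname{SU}(2)\times\operatorname{U}(1)$ with its usual (product) topology. Define maps $r_1,r_2$ from $(S^3\times S^1)\times(S^3\times S^1)$ to itself by $$r_1\big((A_1,z_1),(A_2,z_2)\big)=(p_1,q_1),$$ where $$p_1=\left(\begin{pmatrix}z_1&0\\0&1\end{pmatrix}A_2\begin{pmatrix}z_1^{-1}&0\\0&1\end{pmatrix},\;z_2\right),$$ $$q_1=\left(\begin{pmatrix}z_1z_2^{-1}&0\\0&1\end{pmatrix}A_2^{-1}\begin{pmatrix}z_1^{-1}&0\\0&1\end{pmatrix}A_1\begin{pmatrix}z_1&0\\0&1\end{pmatrix}A_2\begin{pmatrix}z_1^{-1}z_2&0\\0&1\end{pmatrix},\;z_1\right),$$ and $$r_2\big((A_1,z_1),(A_2,z_2)\big)=(p_2,q_2),$$ where $$p_2=\left(\begin{pmatrix}z_1^{-1}&0\\0&1\end{pmatrix}A_2\begin{pmatrix}z_1&0\\0&1\end{pmatrix},\;z_2\right),$$ $$q_2=\left(\begin{pmatrix}z_1^{-1}&0\\0&1\end{pmatrix}A_2^{-1}\begin{pmatrix}z_1&0\\0&1\end{pmatrix}A_1A_2,\;z_1\right),$$ for $A_1,A_2\in\operatorname{SU}(2)$ and $z_1,z_2\in\operatorname{U}(1)$. Then both $(S^3\times S^1,r_1)$ and $(S^3\times S^1,r_2)$ are topological biquandles.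
   Context: A biquandle is a set $X$ with a bijective map $r:X\times X\to X\times X$, written $r(a,b)=(b\star a,\,a\ast b)$ (this defines the two binary operations $\star$ and $\ast$ on $X$), satisfying the following axioms. (1) $r$ satisfies the set-theoretic Yang-Baxter equation $(\mathrm{Id}\times r)\circ(r\times\mathrm{Id})\circ(\mathrm{Id}\times r)=(r\times\mathrm{Id})\circ(\mathrm{Id}\times r)\circ(r\times\mathrm{Id})$ on $X\times X\times X$ (here $\circ$ is composition of maps). (2) For every $a\in X$, the maps $\star a:X\to X$, $x\mapsto x\star a$, and $\ast a:X\to X$, $x\mapsto x\ast a$, are both bijective; these induce a unique bijective map $S:X\times X\to X\times X$ such that $S(b\star a,\,a)=(a\ast b,\,b)$ for all $a,b\in X$. (3) $S$ induces a bijection $\tau:X\to X$ on the diagonal, i.e. $S(a,a)=(\tau(a),\tau(a))$ for all $a\in X$, with $\tau$ bijective. A topological biquandle is a topological space $X$ with a biquandle structure such that both operations $\ast,\star:X\times X\to X$ are continuous. Here $\operatorname{U}(1)=\{z\in\mathbb{C}:|z|=1\}$. *)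

theory Defs
  imports "HOL-Analysis.Analysis"
begin

text \<open>
  A biquandle is given by a carrier \<open>X\<close> and a map \<open>r\<close>, of which only the restriction to
  \<open>X \<times> X\<close> matters. The two operations are read off from \<open>r (a, b) = (b \<star> a, a \<^bold>* b)\<close>; note
  the swapped arguments in the first component.
\<close>

definition bq_star :: "('a \<times> 'a \<Rightarrow> 'a \<times> 'a) \<Rightarrow> 'a \<Rightarrow> 'a \<Rightarrow> 'a" where
  "bq_star r b a = fst (r (a, b))"

definition bq_ast :: "('a \<times> 'a \<Rightarrow> 'a \<times> 'a) \<Rightarrow> 'a \<Rightarrow> 'a \<Rightarrow> 'a" where
  "bq_ast r a b = snd (r (a, b))"

definition id_times :: "('a \<times> 'a \<Rightarrow> 'a \<times> 'a) \<Rightarrow> 'a \<times> 'a \<times> 'a \<Rightarrow> 'a \<times> 'a \<times> 'a" where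
  "id_times r = (\<lambda>(a, b, c). (a, r (b, c)))"

definition times_id :: "('a \<times> 'a \<Rightarrow> 'a \<times> 'a) \<Rightarrow> 'a \<times> 'a \<times> 'a \<Rightarrow> 'a \<times> 'a \<times> 'a" where
  "times_id r = (\<lambda>(a, b, c). (fst (r (a, b)), snd (r (a, b)), c))"

definition yang_baxter_on :: "'a set \<Rightarrow> ('a \<times> 'a \<Rightarrow> 'a \<times> 'a) \<Rightarrow> bool" where
  "yang_baxter_on X r \<longleftrightarrow>
     (\<forall>t \<in> X \<times> X \<times> X.
        (id_times r \<circ> times_id r \<circ> id_times r) t = (times_id r \<circ> id_times r \<circ> times_id r) t)"

text \<open>
  The map \<open>S\<close> of the second axiom. It is a map on \<open>X \<times> X\<close>; extensionality fixes its junk values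
  outside of the carrier, so that uniqueness can be expressed by \<open>\<exists>!\<close>.
\<close>

definition bq_sideways ::
  "'a set \<Rightarrow> ('a \<times> 'a \<Rightarrow> 'a \<times> 'a) \<Rightarrow> ('a \<times> 'a \<Rightarrow> 'a \<times> 'a) \<Rightarrow> bool" where
  "bq_sideways X r S \<longleftrightarrow>
     S \<in> extensional (X \<times> X) \<and> bij_betw S (X \<times> X) (X \<times> X) \<and>
     (\<forall>a\<in>X. \<forall>b\<in>X. S (bq_star r b a, a) = (bq_ast r a b, b))"

definition biquandle :: "'a set \<Rightarrow> ('a \<times> 'a \<Rightarrow> 'a \<times> 'a) \<Rightarrow> bool" where
  "biquandle X r \<longleftrightarrow>
     bij_betw r (X \<times> X) (X \<times> X) \<and>
     yang_baxter_on X r \<and>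
     (\<forall>a\<in>X. bij_betw (\<lambda>x. bq_star r x a) X X \<and> bij_betw (\<lambda>x. bq_ast r x a) X X) \<and>
     (\<exists>!S. bq_sideways X r S) \<and>
     (\<exists>S \<tau>. bq_sideways X r S \<and> bij_betw \<tau> X X \<and> (\<forall>a\<in>X. S (a, a) = (\<tau> a, \<tau> a)))"

definition topological_biquandle :: "'a topology \<Rightarrow> ('a \<times> 'a \<Rightarrow> 'a \<times> 'a) \<Rightarrow> bool" where
  "topological_biquandle T r \<longleftrightarrow>
     biquandle (topspace T) r \<and>
     continuous_map (prod_topology T T) T (\<lambda>(x, y). bq_ast r x y) \<and>
     continuous_map (prod_topology T T) T (\<lambda>(x, y). bq_star r x y)"

definition conj_transpose :: "complex^'n^'m \<Rightarrow> complex^'m^'n" where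
  "conj_transpose A = (\<chi> i j. cnj (A $ j $ i))"

definition special_unitary :: "(complex^'n^'n) set" where
  "special_unitary =
     {A. conj_transpose A ** A = mat 1 \<and> A ** conj_transpose A = mat 1 \<and> det A = 1}"

abbreviation SU2 :: "(complex^2^2) set" where
  "SU2 \<equiv> special_unitary"

definition U1 :: "complex set" where
  "U1 = {z. cmod z = 1}"

text \<open>
  The space \<open>S\<^sup>3 \<times> S\<^sup>1\<close> in its identification with \<open>SU(2) \<times> U(1)\<close>: the product of the
  subspace topologies inherited from the complex matrices and the complex numbers.
\<close>

definition S3_S1 :: "((complex^2^2) \<times> complex) topology" where
  "S3_S1 = prod_topology (top_of_set SU2) (top_of_set U1)"

definition dmat :: "complex \<Rightarrow> complex^2^2" where
  "dmat z = vector [vector [z, 0], vector [0, 1]]"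

definition r1 ::
  "((complex^2^2) \<times> complex) \<times> ((complex^2^2) \<times> complex) \<Rightarrow>
   ((complex^2^2) \<times> complex) \<times> ((complex^2^2) \<times> complex)" where
  "r1 = (\<lambda>((A1, z1), (A2, z2)).
     ((dmat z1 ** A2 ** dmat (inverse z1), z2),
      (dmat (z1 * inverse z2) ** matrix_inv A2 ** dmat (inverse z1) ** A1 ** dmat z1 ** A2
         ** dmat (inverse z1 * z2), z1)))"

definition r2 ::
  "((complex^2^2) \<times> complex) \<times> ((complex^2^2) \<times> complex) \<Rightarrow>
   ((complex^2^2) \<times> complex) \<times> ((complex^2^2) \<times> complex)" where
  "r2 = (\<lambda>((A1, z1), (A2, z2)).
     ((dmat (inverse z1) ** A2 ** dmat z1, z2),
      (dmat (inverse z1) ** matrix_inv A2 ** dmat z1 ** A1 ** A2, z1)))"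

end

theory Submission
  imports Defs "HOL-Algebra.Group"
begin

text \<open>
  Conjugation by \<open>diag(z, 1)\<close> is an automorphism \<open>\<phi>\<^sub>z\<close> of \<open>SU(2)\<close>, and these automorphisms
  commute with each other, since diagonal matrices do. Writing \<open>\<psi>\<^sub>z\<close> for the inverse of
  \<open>\<phi>\<^sub>z\<close>, the two maps of the theorem become
    \<^item> \<open>r\<^sub>1 ((A, z), (B, w)) = ((P, w), (\<psi>\<^sub>w (P\<^sup>-\<^sup>1 A P), z))\<close> with \<open>P = \<phi>\<^sub>z B\<close>,
    \<^item> \<open>r\<^sub>2 ((A, z), (B, w)) = ((Q, w), (Q\<^sup>-\<^sup>1 A B, z))\<close> with \<open>Q = \<psi>\<^sub>z B\<close>.

  So both are deformations of the conjugation braiding \<open>(A, B) \<mapsto> (B, B\<^sup>-\<^sup>1 A B)\<close> of a group,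
  in which the circle coordinates are merely exchanged and serve as labels that select the
  automorphisms to apply. The algebra takes place in this generality: for every group with a
  family of commuting automorphisms, these two formulas define biquandles
  (\<open>biquandle_twisted_conjugation\<close> and \<open>biquandle_product_preserving\<close>).

  The Yang-Baxter equation is an identity of group words in \<open>A\<close>, \<open>B\<close>, \<open>C\<close> to which automorphisms
  are applied. For \<open>r\<^sub>1\<close> and labels \<open>z\<close>, \<open>w\<close>, \<open>v\<close>, both sides are the triple with group components
  \<open>\<phi>\<^sub>z \<phi>\<^sub>w C\<close>, \<open>\<psi>\<^sub>v \<phi>\<^sub>z ((\<phi>\<^sub>w C)\<^sup>-\<^sup>1 B (\<phi>\<^sub>w C))\<close> and \<open>\<psi>\<^sub>v \<psi>\<^sub>w (T\<^sup>-\<^sup>1 A T)\<close>, where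
  \<open>T = \<phi>\<^sub>z (B (\<phi>\<^sub>w C))\<close>. For \<open>r\<^sub>2\<close> the product of the two group components is preserved by \<open>r\<^sub>2\<close>,
  hence \<open>A B C\<close> is preserved by both sides; they have the same first two components
  \<open>\<psi>\<^sub>z \<psi>\<^sub>w C\<close> and \<open>\<psi>\<^sub>z ((\<psi>\<^sub>w C)\<^sup>-\<^sup>1 B C)\<close>, and therefore the same third one.

  The bijectivity axioms hold because the formulas can be solved for each of the unknowns. The
  sideways map \<open>S\<close> then exists and is unique for formal reasons (\<open>biquandleI\<close>), and its diagonal map
  sends \<open>(A, z)\<close> to \<open>(\<psi>\<^sub>z A, z)\<close> for \<open>r\<^sub>1\<close> and to \<open>(\<phi>\<^sub>z A, z)\<close> for \<open>r\<^sub>2\<close>. Continuity holds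
  since inversion on \<open>SU(2)\<close> is the conjugate transpose and inversion on \<open>U(1)\<close> is continuous.
\<close>

section \<open>Reducing the sideways axioms\<close>

lemma bij_swap_on: "bij_betw prod.swap (A \<times> B) (B \<times> A)"
  by (rule bij_betw_byWitness[where f' = prod.swap]) auto

lemma bij_betw_fibrewise:
  assumes "\<And>a. a \<in> X \<Longrightarrow> bij_betw (f a) X X"
  shows "bij_betw (\<lambda>(a, b). (f a b, a)) (X \<times> X) (X \<times> X)"
proof (rule bij_betw_imageI)
  show "inj_on (\<lambda>(a, b). (f a b, a)) (X \<times> X)"
    using assms by (auto simp: inj_on_def bij_betw_def)
  have "c \<in> f a ` X" "f a c \<in> X" if "a \<in> X" "c \<in> X" for a c
    using assms that by (auto simp: bij_betw_def)
  then show "(\<lambda>(a, b). (f a b, a)) ` (X \<times> X) = X \<times> X"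
    by (fastforce simp: image_iff)
qed

text \<open>
  The condition on \<open>S\<close> says \<open>S \<circ> F = H\<close> for \<open>F (a, b) = (b \<star> a, a)\<close> and
  \<open>H (a, b) = (a \<^bold>* b, b)\<close>. Both are bijections as soon as all translations are, so
  \<open>S = H \<circ> F\<^sup>-\<^sup>1\<close> is forced. In particular \<open>S (a, a)\<close> is read off from the only \<open>b\<close> with
  \<open>b \<star> a = a\<close>; this \<open>b\<close> is the \<open>\<tau> a\<close> of the hypotheses.
\<close>
lemma biquandleI:
  assumes r: "bij_betw r (X \<times> X) (X \<times> X)"
    and yb: "yang_baxter_on X r"
    and star: "\<And>a. a \<in> X \<Longrightarrow> bij_betw (\<lambda>x. bq_star r x a) X X"
    and ast: "\<And>a. a \<in> X \<Longrightarrow> bij_betw (\<lambda>x. bq_ast r x a) X X"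
    and \<tau>: "bij_betw \<tau> X X"
    and \<tau>_star: "\<And>a. a \<in> X \<Longrightarrow> bq_star r (\<tau> a) a = a"
    and \<tau>_ast: "\<And>a. a \<in> X \<Longrightarrow> bq_ast r a (\<tau> a) = \<tau> a"
  shows "biquandle X r"
proof -
  define F where "F = (\<lambda>(a, b). (bq_star r b a, a))"
  define H where "H = (\<lambda>(a, b). (bq_ast r a b, b))"
  have F: "bij_betw F (X \<times> X) (X \<times> X)"
    unfolding F_def using bij_betw_fibrewise[of X "\<lambda>a b. bq_star r b a"] star by blast
  have "bij_betw (H \<circ> prod.swap) (X \<times> X) (X \<times> X)"
    using bij_betw_fibrewise[of X "\<lambda>b a. bq_ast r a b"] ast by (simp add: H_def comp_def case_prod_unfold)
  then have H: "bij_betw H (X \<times> X) (X \<times> X)"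
    using bij_betw_comp_iff[OF bij_swap_on, of H X X "X \<times> X"] by simp
  define S where "S = restrict (H \<circ> the_inv_into (X \<times> X) F) (X \<times> X)"
  have S_F: "S (F p) = H p" if "p \<in> X \<times> X" for p
    using that F by (simp add: S_def bij_betwE the_inv_into_f_f bij_betw_imp_inj_on)
  have "bij_betw S (X \<times> X) (X \<times> X)"
    unfolding S_def using bij_betw_trans[OF bij_betw_the_inv_into[OF F] H] by simp
  then have S: "bq_sideways X r S"
    unfolding bq_sideways_def using S_F by (force simp: F_def H_def S_def)
  have unique: "S' = S" if "bq_sideways X r S'" for S'
  proof (rule extensionalityI)
    show "S' \<in> extensional (X \<times> X)" "S \<in> extensional (X \<times> X)"
      using S that by (simp_all add: bq_sideways_def)
    fix q assume "q \<in> X \<times> X"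
    then obtain p where p: "p \<in> X \<times> X" "q = F p"
      using F by (metis bij_betw_imp_surj_on imageE)
    then have "S' (F p) = H p"
      using that by (auto simp: bq_sideways_def F_def H_def)
    then show "S' q = S q" using S_F p by simp
  qed
  have "S (a, a) = (\<tau> a, \<tau> a)" if "a \<in> X" for a
    using S_F[of "(a, \<tau> a)"] that bij_betwE[OF \<tau>] by (simp add: F_def H_def \<tau>_star \<tau>_ast)
  then show ?thesis
    unfolding biquandle_def using r yb star ast \<tau> S unique by blast
qed

section \<open>Biquandles from commuting automorphisms of a group\<close>

text \<open>
  For \<open>SU(2)\<close> the labels in \<open>Z\<close> are the points of the circle. Naming the inverse \<open>\<psi> z\<close> of \<open>\<phi> z\<close>
  explicitly makes every law below an equation that can be used for rewriting.
\<close>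
locale commuting_automorphisms = group G for G (structure) +
  fixes Z :: "'z set" and \<phi> \<psi> :: "'z \<Rightarrow> 'a \<Rightarrow> 'a"
  assumes \<phi>_hom: "z \<in> Z \<Longrightarrow> \<phi> z \<in> hom G G"
    and \<psi>_closed: "z \<in> Z \<Longrightarrow> a \<in> carrier G \<Longrightarrow> \<psi> z a \<in> carrier G"
    and \<phi>_\<psi>: "z \<in> Z \<Longrightarrow> a \<in> carrier G \<Longrightarrow> \<phi> z (\<psi> z a) = a"
    and \<psi>_\<phi>: "z \<in> Z \<Longrightarrow> a \<in> carrier G \<Longrightarrow> \<psi> z (\<phi> z a) = a"
    and \<phi>_commute: "z \<in> Z \<Longrightarrow> w \<in> Z \<Longrightarrow> a \<in> carrier G \<Longrightarrow> \<phi> z (\<phi> w a) = \<phi> w (\<phi> z a)"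
begin

lemma \<phi>_closed: "z \<in> Z \<Longrightarrow> a \<in> carrier G \<Longrightarrow> \<phi> z a \<in> carrier G"
  using \<phi>_hom hom_in_carrier by metis

lemma \<phi>_mult: "z \<in> Z \<Longrightarrow> a \<in> carrier G \<Longrightarrow> b \<in> carrier G \<Longrightarrow> \<phi> z (a \<otimes> b) = \<phi> z a \<otimes> \<phi> z b"
  using \<phi>_hom hom_mult by metis

lemma \<phi>_inv: "z \<in> Z \<Longrightarrow> a \<in> carrier G \<Longrightarrow> \<phi> z (inv a) = inv (\<phi> z a)"
  by (metis \<phi>_hom group_axioms group_hom.hom_inv group_hom.intro group_hom_axioms.intro)

lemma \<psi>_mult:
  assumes "z \<in> Z" "a \<in> carrier G" "b \<in> carrier G"
  shows "\<psi> z (a \<otimes> b) = \<psi> z a \<otimes> \<psi> z b"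
  by (metis assms \<phi>_\<psi> \<psi>_\<phi> \<phi>_mult \<psi>_closed m_closed)

lemma \<psi>_inv:
  assumes "z \<in> Z" "a \<in> carrier G"
  shows "\<psi> z (inv a) = inv (\<psi> z a)"
  by (metis assms \<phi>_\<psi> \<psi>_\<phi> \<phi>_inv \<psi>_closed inv_closed)

lemma \<phi>_\<psi>_commute:
  assumes "z \<in> Z" "w \<in> Z" "a \<in> carrier G"
  shows "\<phi> z (\<psi> w a) = \<psi> w (\<phi> z a)"
  by (metis assms \<phi>_\<psi> \<psi>_\<phi> \<phi>_commute \<phi>_closed \<psi>_closed)

lemma \<psi>_commute:
  assumes "z \<in> Z" "w \<in> Z" "a \<in> carrier G"
  shows "\<psi> z (\<psi> w a) = \<psi> w (\<psi> z a)"
  by (metis assms \<phi>_\<psi> \<psi>_\<phi> \<phi>_\<psi>_commute \<psi>_closed)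

lemma mult_inv_cancel:
  assumes "a \<in> carrier G" "b \<in> carrier G"
  shows "a \<otimes> (inv a \<otimes> b) = b" "inv a \<otimes> (a \<otimes> b) = b"
  using assms by (simp_all add: m_assoc[symmetric])

text \<open>
  The rewrite rules below move every \<open>\<psi>\<close> outside of every \<open>\<phi>\<close> and sort each of the two blocks
  by a term order, so that inverse pairs need not end up next to each other. Cancelling
  them at these distances suffices for the three labels of the Yang-Baxter equation.
\<close>
lemma \<psi>_\<phi>_cancel:
  assumes "z \<in> Z" "w \<in> Z" "a \<in> carrier G"
  shows "\<psi> z (\<phi> w (\<phi> z a)) = \<phi> w a"
    and "\<psi> z (\<psi> w (\<phi> z a)) = \<psi> w a"
    and "y \<in> Z \<Longrightarrow> \<psi> z (\<psi> w (\<phi> y (\<phi> z a))) = \<psi> w (\<phi> y a)"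
proof -
  have *: "\<psi> z (\<phi> u (\<phi> z b)) = \<phi> u b" if "u \<in> Z" "b \<in> carrier G" for u b
    using assms that by (metis \<phi>_commute \<phi>_closed \<psi>_\<phi>)
  show "\<psi> z (\<phi> w (\<phi> z a)) = \<phi> w a"
    using assms * by blast
  show "\<psi> z (\<psi> w (\<phi> z a)) = \<psi> w a"
    using assms by (metis \<psi>_commute \<phi>_closed \<psi>_\<phi>)
  show "\<psi> z (\<psi> w (\<phi> y (\<phi> z a))) = \<psi> w (\<phi> y a)" if "y \<in> Z"
    using assms that * by (metis \<psi>_commute \<phi>_closed)
qed

text \<open>
  A rewrite system for words in the group elements and the automorphisms: automorphisms are pushed
  down to the letters, ordered and cancelled there, and the remaining group word is reduced.
\<close>
lemmas normalize = \<phi>_closed \<psi>_closed \<phi>_mult \<psi>_mult \<phi>_inv \<psi>_inv \<phi>_\<psi> \<psi>_\<phi>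
  \<phi>_commute \<phi>_\<psi>_commute \<psi>_commute \<psi>_\<phi>_cancel inv_mult_group m_assoc mult_inv_cancel

lemma bij_\<phi>: "bij_betw (\<lambda>(a, z). (\<phi> z a, z)) (carrier G \<times> Z) (carrier G \<times> Z)"
  by (rule bij_betw_byWitness[where f' = "\<lambda>(a, z). (\<psi> z a, z)"]) (auto simp: normalize)

lemma bij_\<psi>: "bij_betw (\<lambda>(a, z). (\<psi> z a, z)) (carrier G \<times> Z) (carrier G \<times> Z)"
  by (rule bij_betw_byWitness[where f' = "\<lambda>(a, z). (\<phi> z a, z)"]) (auto simp: normalize)

text \<open>
  If \<open>((p, w), (q, z))\<close> is the image of \<open>((a, z), (b, w))\<close>, then \<open>p = \<phi> z b\<close> and \<open>p \<otimes> \<phi> w q = a \<otimes> p\<close>;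
  solving these two relations for different unknowns gives all the inverse maps. With
  \<open>b = \<psi> z a\<close> and \<open>w = z\<close> one has \<open>p = a\<close>, so that \<open>a\<close> is conjugated by itself and
  \<open>q = \<psi> z a = b\<close>. This is the diagonal map.
\<close>
lemma biquandle_twisted_conjugation:
  assumes r: "\<And>a z b w. \<lbrakk>a \<in> carrier G; z \<in> Z; b \<in> carrier G; w \<in> Z\<rbrakk> \<Longrightarrow>
    r ((a, z), (b, w)) = ((\<phi> z b, w), (\<psi> w (inv (\<phi> z b) \<otimes> a \<otimes> \<phi> z b), z))"
  shows "biquandle (carrier G \<times> Z) r"
proof (rule biquandleI[where \<tau> = "\<lambda>(a, z). (\<psi> z a, z)"])
  let ?X = "carrier G \<times> Z"
  show "bij_betw r (?X \<times> ?X) (?X \<times> ?X)"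
    by (rule bij_betw_byWitness[where
          f' = "\<lambda>((p, w), (q, z)). ((p \<otimes> \<phi> w q \<otimes> inv p, z), (\<psi> z p, w))"])
       (auto simp: r normalize)
  show "yang_baxter_on ?X r"
    unfolding yang_baxter_on_def
    by (auto simp: id_times_def times_id_def r normalize)
  show "bij_betw (\<lambda>x. bq_star r x c) ?X ?X" if "c \<in> ?X" for c
    using that
    by (intro bij_betw_byWitness[where f' = "\<lambda>(p, w). (\<psi> (snd c) p, w)"])
       (auto simp: bq_star_def r normalize)
  show "bij_betw (\<lambda>x. bq_ast r x c) ?X ?X" if "c \<in> ?X" for c
    using that
    by (intro bij_betw_byWitness[where
          f' = "\<lambda>(q, z). (\<phi> z (fst c) \<otimes> \<phi> (snd c) q \<otimes> inv (\<phi> z (fst c)), z)"])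
       (auto simp: bq_ast_def r normalize)
qed (auto simp: bij_\<psi> bq_star_def bq_ast_def r normalize)

text \<open>
  Here \<open>p = \<psi> z b\<close> and \<open>p \<otimes> q = a \<otimes> b\<close>, and again all inverse maps come from solving these two
  relations. With \<open>b = \<phi> z a\<close> one has \<open>p = a\<close>, hence \<open>q = b\<close>, which is the diagonal map.
\<close>
lemma biquandle_product_preserving:
  assumes r: "\<And>a z b w. \<lbrakk>a \<in> carrier G; z \<in> Z; b \<in> carrier G; w \<in> Z\<rbrakk> \<Longrightarrow>
    r ((a, z), (b, w)) = ((\<psi> z b, w), (inv (\<psi> z b) \<otimes> a \<otimes> b, z))"
  shows "biquandle (carrier G \<times> Z) r"
proof (rule biquandleI[where \<tau> = "\<lambda>(a, z). (\<phi> z a, z)"])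
  let ?X = "carrier G \<times> Z"
  show "bij_betw r (?X \<times> ?X) (?X \<times> ?X)"
    by (rule bij_betw_byWitness[where
          f' = "\<lambda>((p, w), (q, z)). ((p \<otimes> q \<otimes> inv (\<phi> z p), z), (\<phi> z p, w))"])
       (auto simp: r normalize)
  show "yang_baxter_on ?X r"
    unfolding yang_baxter_on_def
    by (auto simp: id_times_def times_id_def r normalize)
  show "bij_betw (\<lambda>x. bq_star r x c) ?X ?X" if "c \<in> ?X" for c
    using that
    by (intro bij_betw_byWitness[where f' = "\<lambda>(p, w). (\<phi> (snd c) p, w)"])
       (auto simp: bq_star_def r normalize)
  show "bij_betw (\<lambda>x. bq_ast r x c) ?X ?X" if "c \<in> ?X" for c
    using that
    by (intro bij_betw_byWitness[where
          f' = "\<lambda>(q, z). (\<psi> z (fst c) \<otimes> q \<otimes> inv (fst c), z)"])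
       (auto simp: bq_ast_def r normalize)
qed (auto simp: bij_\<phi> bq_star_def bq_ast_def r normalize)

end

section \<open>Topological biquandles from one continuous map\<close>

lemma topological_biquandleI:
  fixes X :: "'a :: topological_space set"
  assumes r: "biquandle X r" and cont: "continuous_on (X \<times> X) r"
  shows "topological_biquandle (top_of_set X) r"
proof -
  have maps: "r p \<in> X \<times> X" if "p \<in> X \<times> X" for p
    using r that bij_betwE unfolding biquandle_def by blast
  have "continuous_on (X \<times> X) (\<lambda>p. r (snd p, fst p))"
    by (rule continuous_on_compose2[OF cont]) (auto intro!: continuous_intros)
  then show ?thesis
    using r cont maps
    by (auto simp: topological_biquandle_def bq_ast_def bq_star_def case_prod_unfold mem_Times_iff
        intro!: continuous_intros)
qed

section \<open>The special unitary group\<close>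

lemma matrix_inv_eq:
  fixes A :: "'a::semiring_1^'n^'m"
  assumes "A ** B = mat 1" "B ** A = mat 1"
  shows "matrix_inv A = B"
proof -
  have "A ** matrix_inv A = mat 1 \<and> matrix_inv A ** A = mat 1"
    unfolding matrix_inv_def by (rule someI[of _ B]) (use assms in simp)
  then show ?thesis
    using assms(2) by (metis matrix_mul_assoc matrix_mul_lid matrix_mul_rid)
qed

lemma conj_transpose_mult: "conj_transpose (A ** B) = conj_transpose B ** conj_transpose A"
  by (simp add: conj_transpose_def matrix_matrix_mult_def vec_eq_iff mult.commute)

lemma conj_transpose_conj_transpose: "conj_transpose (conj_transpose A) = A"
  by (simp add: conj_transpose_def vec_eq_iff)

lemma det_conj_transpose: "det (conj_transpose A) = cnj (det A)"
proof -
  have "det (conj_transpose A) = det (\<chi> i j. cnj (A $ i $ j))"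
    by (subst det_transpose[symmetric]) (simp add: transpose_def conj_transpose_def)
  also have "\<dots> = cnj (det A)"
    by (simp add: det_def)
  finally show ?thesis .
qed

definition SU_group :: "(complex^'n^'n) monoid" where
  "SU_group = \<lparr>carrier = special_unitary, mult = (**), one = mat 1\<rparr>"

lemma SU_group_simps [simp]:
  "carrier SU_group = special_unitary"
  "A \<otimes>\<^bsub>SU_group\<^esub> B = A ** B"
  "\<one>\<^bsub>SU_group\<^esub> = mat 1"
  by (simp_all add: SU_group_def)

lemma conj_transpose_mat_1: "conj_transpose (mat 1) = mat 1"
  by (auto simp: conj_transpose_def mat_def vec_eq_iff)

lemma special_unitary_mult:
  assumes "A \<in> special_unitary" "B \<in> special_unitary"
  shows "A ** B \<in> special_unitary"
  using assms unfolding special_unitary_def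
  by (simp add: conj_transpose_mult det_mul) (metis matrix_mul_assoc matrix_mul_lid)

lemma group_SU_group: "Group.group SU_group"
proof (rule groupI)
  fix A :: "complex^'n^'n" assume "A \<in> carrier SU_group"
  then show "\<exists>B\<in>carrier SU_group. B \<otimes>\<^bsub>SU_group\<^esub> A = \<one>\<^bsub>SU_group\<^esub>"
    by (intro bexI[of _ "conj_transpose A"])
       (auto simp: special_unitary_def conj_transpose_conj_transpose det_conj_transpose)
next
  show "\<one>\<^bsub>SU_group\<^esub> \<in> carrier SU_group"
    by (simp add: special_unitary_def conj_transpose_mat_1)
qed (simp_all add: special_unitary_mult matrix_mul_assoc)

lemma matrix_inv_special_unitary:
  "A \<in> special_unitary \<Longrightarrow> matrix_inv A = conj_transpose A"
  by (intro matrix_inv_eq) (auto simp: special_unitary_def)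

lemma inv_SU_group:
  assumes "A \<in> special_unitary"
  shows "inv\<^bsub>SU_group\<^esub> A = matrix_inv A"
  by (rule group.inv_equality[OF group_SU_group])
     (use assms in \<open>auto simp: matrix_inv_special_unitary special_unitary_def
        conj_transpose_conj_transpose det_conj_transpose\<close>)

section \<open>Conjugation of SU(2) by diagonal matrices\<close>

lemma dmat_nth: "dmat z $ i $ j = (if i \<noteq> j then 0 else if i = 1 then z else 1)"
  using exhaust_2[of i] exhaust_2[of j] by (auto simp: dmat_def)

lemma dmat_mult: "dmat (z * w) = dmat z ** dmat w"
  by (simp add: vec_eq_iff matrix_matrix_mult_def dmat_nth sum_2 forall_2)

lemma dmat_1: "dmat 1 = mat 1"
  by (simp add: vec_eq_iff dmat_nth mat_def)

lemma conj_transpose_dmat: "conj_transpose (dmat z) = dmat (cnj z)"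
  by (simp add: vec_eq_iff conj_transpose_def dmat_nth)

lemma U1_nonzero: "z \<in> U1 \<Longrightarrow> z \<noteq> 0"
  by (auto simp: U1_def)

lemma cnj_U1: "z \<in> U1 \<Longrightarrow> cnj z = inverse z"
  by (rule inverse_unique[symmetric]) (simp add: U1_def complex_norm_square[symmetric])

lemma inverse_U1: "z \<in> U1 \<Longrightarrow> inverse z \<in> U1"
  by (simp add: U1_def norm_inverse)

definition dconj :: "complex \<Rightarrow> complex^2^2 \<Rightarrow> complex^2^2" where
  "dconj z A = dmat z ** A ** dmat (inverse z)"

lemma dmat_cancel:
  assumes "z \<in> U1"
  shows "dmat z ** dmat (inverse z) = mat 1" "dmat (inverse z) ** dmat z = mat 1"
    "A ** dmat z ** dmat (inverse z) = A" "A ** dmat (inverse z) ** dmat z = A"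
proof -
  show 1: "dmat z ** dmat (inverse z) = mat 1" "dmat (inverse z) ** dmat z = mat 1"
    using U1_nonzero[OF assms] by (simp_all add: dmat_mult[symmetric] dmat_1)
  show "A ** dmat z ** dmat (inverse z) = A" "A ** dmat (inverse z) ** dmat z = A"
    by (simp_all add: matrix_mul_assoc[symmetric] 1)
qed

text \<open>
  For \<open>|z| = 1\<close> the matrix \<open>dmat z\<close> is unitary, but its determinant is \<open>z\<close>. Hence conjugation by
  it commutes with the adjoint, and the determinants of \<open>dmat z\<close> and of its inverse cancel.
\<close>
lemma dconj_in_SU2:
  assumes z: "z \<in> U1" and A: "A \<in> SU2"
  shows "dconj z A \<in> SU2"
proof -
  have adj: "conj_transpose (dconj z A) = dconj z (conj_transpose A)"
    using z by (simp add: dconj_def conj_transpose_mult conj_transpose_dmat cnj_U1 inverse_U1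
        matrix_mul_assoc)
  have hom: "dconj z B ** dconj z C = dconj z (B ** C)" for B C
    using z by (simp add: dconj_def matrix_mul_assoc dmat_cancel)
  have one: "dconj z (mat 1) = mat 1"
    using z by (simp add: dconj_def dmat_cancel)
  have "det (dmat z) * det (dmat (inverse z)) = 1"
    using z by (simp add: det_mul[symmetric] dmat_cancel)
  then have "det (dconj z A) = det A"
    by (simp add: dconj_def det_mul mult.commute mult.left_commute)
  then show ?thesis
    using A by (simp add: special_unitary_def adj hom one)
qed

interpretation SU2: commuting_automorphisms SU_group U1 dconj "\<lambda>z. dconj (inverse z)"
proof (intro commuting_automorphisms.intro commuting_automorphisms_axioms.intro group_SU_group)
  fix z A assume z: "z \<in> U1"
  show "dconj z \<in> hom SU_group SU_group"
    using z by (auto simp: hom_def dconj_in_SU2) (simp add: dconj_def matrix_mul_assoc dmat_cancel)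
  show "dconj (inverse z) A \<in> carrier SU_group" if "A \<in> carrier SU_group"
    using z that by (simp add: dconj_in_SU2 inverse_U1)
  show "dconj z (dconj (inverse z) A) = A" "dconj (inverse z) (dconj z A) = A"
    using z by (simp_all add: dconj_def matrix_mul_assoc dmat_cancel)
  show "dconj z (dconj w A) = dconj w (dconj z A)" for w
  proof -
    have "dconj z (dconj w A) = dmat (z * w) ** A ** dmat (inverse z * inverse w)" for z w
      by (simp add: dconj_def matrix_mul_assoc dmat_mult mult.commute[of "inverse z"])
    then show ?thesis by (simp add: mult.commute)
  qed
qed

section \<open>The two biquandle structures on SU(2) x U(1)\<close>

lemma biquandle_r1: "biquandle (SU2 \<times> U1) r1"
proof -
  have "r1 ((A, z), (B, w)) = ((dconj z B, w),
      (dconj (inverse w) (inv\<^bsub>SU_group\<^esub> (dconj z B) ** A ** dconj z B), z))"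
    if "A \<in> SU2" "z \<in> U1" "B \<in> SU2" "w \<in> U1" for A z B w
  proof -
    have "inv\<^bsub>SU_group\<^esub> (dconj z B) = dconj z (matrix_inv B)"
      using that SU2.\<phi>_inv[of z B] by (simp add: inv_SU_group)
    moreover have "dmat (z * inverse w) = dmat (inverse w) ** dmat z"
      by (simp add: dmat_mult[symmetric] mult.commute)
    ultimately show ?thesis
      by (simp add: r1_def dconj_def matrix_mul_assoc dmat_mult)
  qed
  then show ?thesis
    using SU2.biquandle_twisted_conjugation[of r1] by simp
qed

lemma biquandle_r2: "biquandle (SU2 \<times> U1) r2"
proof -
  have "r2 ((A, z), (B, w)) = ((dconj (inverse z) B, w),
      (inv\<^bsub>SU_group\<^esub> (dconj (inverse z) B) ** A ** B, z))"
    if "A \<in> SU2" "z \<in> U1" "B \<in> SU2" "w \<in> U1" for A z B w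
  proof -
    have "inv\<^bsub>SU_group\<^esub> (dconj (inverse z) B) = dconj (inverse z) (matrix_inv B)"
      using that SU2.\<psi>_inv[of z B] by (simp add: inv_SU_group)
    then show ?thesis
      by (simp add: r2_def dconj_def matrix_mul_assoc)
  qed
  then show ?thesis
    using SU2.biquandle_product_preserving[of r2] by simp
qed

section \<open>Continuity\<close>

lemma continuous_on_matrix_mult [continuous_intros]:
  fixes f :: "'a::topological_space \<Rightarrow> complex^'n^'m"
  assumes "continuous_on S f" "continuous_on S g"
  shows "continuous_on S (\<lambda>x. f x ** g x)"
  unfolding matrix_matrix_mult_def by (intro continuous_intros assms)

lemma continuous_on_dmat [continuous_intros]:
  assumes "continuous_on S f"
  shows "continuous_on S (\<lambda>x. dmat (f x))"
proof -
  have "dmat z = (\<chi> i j. if i = j then if i = 1 then z else 1 else 0)" for z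
    by (simp add: vec_eq_iff dmat_nth)
  moreover have "continuous_on S (\<lambda>x. if i = j then if i = 1 then f x else 1 else 0)" for i j :: 2
    using assms by (cases "i = j"; cases "i = 1") simp_all
  ultimately show ?thesis
    by (simp add: continuous_on_vec_lambda)
qed

text \<open>
  On the special unitary group inversion is the restriction of the conjugate transpose, which is
  continuous on all matrices.
\<close>
lemma continuous_on_matrix_inv [continuous_intros]:
  assumes "continuous_on S f" "\<And>x. x \<in> S \<Longrightarrow> f x \<in> special_unitary"
  shows "continuous_on S (\<lambda>x. matrix_inv (f x))"
proof -
  have "continuous_on S (\<lambda>x. conj_transpose (f x))"
    unfolding conj_transpose_def by (intro continuous_intros assms)
  then show ?thesis
    by (rule continuous_on_eq) (simp add: assms matrix_inv_special_unitary)
qed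

lemma continuous_r1: "continuous_on ((SU2 \<times> U1) \<times> (SU2 \<times> U1)) r1"
  unfolding r1_def case_prod_unfold
  by (intro continuous_intros) (auto simp: U1_nonzero)

lemma continuous_r2: "continuous_on ((SU2 \<times> U1) \<times> (SU2 \<times> U1)) r2"
  unfolding r2_def case_prod_unfold
  by (intro continuous_intros) (auto simp: U1_nonzero)

theorem corollary3p12:
  shows "topological_biquandle S3_S1 r1 \<and> topological_biquandle S3_S1 r2"
proof -
  have "S3_S1 = top_of_set (SU2 \<times> U1)"
    by (simp add: S3_S1_def)
  then show ?thesis
    using topological_biquandleI biquandle_r1 biquandle_r2 continuous_r1 continuous_r2 by metis
qed

end
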